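(* Let $k,p\ge 1$ and consider the $p$-periodic difference equation $x_{n+1}=F_n(x_n,x_{n-1},\ldots,x_{n-k+1})$, $n\ge0$, with $X_0=(x_0,\ldots,x_{1-k})\in\mathbb{R}_+^k$, where the maps $F_n:\mathbb{R}_+^k\to\mathbb{R}_+$ are continuous, $F_{n+p}=F_n$ for all $n\ge 0$ with $p$ the minimal positive such integer, and for some fixed $\tau:\{1,\ldots,k\}\to\{-1,1\}$ every $F_j$ is increasing with respect to $\leq_\tau$ (that is, $X\leq_\tau Y\Rightarrow F_j(X)\le F_j(Y)$). Suppose that the equation has a unique $q$-cycle and no pseudo-cycles. Suppose also that for each $X_0\in\mathbb{R}_+^k$ there exist $x<y$ in $\mathbb{R}_+$ such that $P_\tau<_\tau X_0<_\tau P_\tau^t$ and $(x,y)<_\lambda(F_j(P_\tau),F_j(P_\tau^t))$ for every $j=0,\ldots,p-1$. Then $\omega(X_0)=Per([F_0,\ldots,F_{p-1}])$ for each $X_0\in\mathbb{R}_+^k$. In particular, the equation has a globally attracting $q$-cycle for some divisor $q$ of $p$.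
   Context: $\mathbb{R}_+=[0,\infty)$. The ordering $\leq_\tau$ on $\mathbb{R}_+^k$ is: $(x_1,\ldots,x_k)\leq_\tau(y_1,\ldots,y_k)$ iff for all $i$, $x_i\le y_i$ when $\tau(i)=1$ and $x_i\ge y_i$ when $\tau(i)=-1$; $X<_\tau Y$ means $X\leq_\tau Y$ and $X\ne Y$. On pairs of reals, $(x,y)<_\lambda(x',y')$ means $x\le x'$, $y'\le y$ and $(x,y)\neq(x',y')$. For $x,y\in\mathbb{R}_+$, $P_\tau\in\mathbb{R}_+^k$ has $i$-th entry $x$ if $\tau(i)=1$ and $y$ if $\tau(i)=-1$, and $P_\tau^t$ is obtained from $P_\tau$ by switching $x$ and $y$. For each $j$, the map $G_j:\mathbb{R}_+^k\times\mathbb{R}_+^k\to\mathbb{R}_+^k\times\mathbb{R}_+^k$ is defined, for $X=(x_1,\ldots,x_k)$, $U=(u_1,\ldots,u_k)$, as follows. For $1\le i\le k-1$ put $y_{i+1}=x_i$, $z_{i+1}=u_i$ if $\tau(i)\tau(i+1)=1$, and $y_{i+1}=u_i$, $z_{i+1}=x_i$ if $\tau(i)\tau(i+1)=-1$. If $\tau(1)=1$, $G_j(X,U)=(F_j(X),y_2,\ldots,y_k,F_j(U),z_2,\ldots,z_k)$; if $\tau(1)=-1$, $G_j(X,U)=(F_j(U),y_2,\ldots,y_k,F_j(X),z_2,\ldots,z_k)$. Put $G_{n+p}=G_n$ and consider the $p$-periodic system $\xi_{n+1}=G_n(\xi_n)$. A $q$-cycle of a $p$-periodic equation is a solution (started at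 time $0$) that is periodic with minimal period $q$. Writing $X_n=(x_n,\ldots,x_{n-k+1})$, each $q$-cycle of the scalar equation yields a $q$-cycle $\xi_n=(X_n,X_n)$ of $\xi_{n+1}=G_n(\xi_n)$. A $q$-cycle, with $q$ a divisor of $p$, of $\xi_{n+1}=G_n(\xi_n)$ (equivalently, one arising from a fixed point of $G_{p-1}\circ\cdots\circ G_0$) that does not arise in this way from a $q$-cycle of the scalar equation is called a pseudo-cycle of the scalar equation. $Per([F_0,\ldots,F_{p-1}])$ denotes the set of points (values) of the periodic solutions of the scalar equation, and $\omega(X_0)$ is the set of limit points of the orbit $\{x_n\}$ with initial condition $X_0$. A cycle is globally attracting if every solution of the equation converges to it. *)

theory Defs
  imports "HOL-Analysis.Analysis"
begin

text \<open>
  Vectors in \<open>\<real>\<^sub>+\<^sup>k\<close> are extensional functions on \<open>{1..k}\<close>. The topology on \<open>nat \<Rightarrow> real\<close> is the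
  product topology, which restricts to the usual one on this set.
\<close>

definition orthant :: "nat \<Rightarrow> (nat \<Rightarrow> real) set" where
  "orthant k = ({1..k} \<rightarrow>\<^sub>E {0..})"

definition tau_le :: "nat \<Rightarrow> (nat \<Rightarrow> int) \<Rightarrow> (nat \<Rightarrow> real) \<Rightarrow> (nat \<Rightarrow> real) \<Rightarrow> bool" where
  "tau_le k \<tau> X Y \<longleftrightarrow>
     (\<forall>i\<in>{1..k}. (\<tau> i = 1 \<longrightarrow> X i \<le> Y i) \<and> (\<tau> i = -1 \<longrightarrow> X i \<ge> Y i))"

definition tau_less :: "nat \<Rightarrow> (nat \<Rightarrow> int) \<Rightarrow> (nat \<Rightarrow> real) \<Rightarrow> (nat \<Rightarrow> real) \<Rightarrow> bool" where
  "tau_less k \<tau> X Y \<longleftrightarrow> tau_le k \<tau> X Y \<and> X \<noteq> Y"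

definition lambda_less :: "real \<times> real \<Rightarrow> real \<times> real \<Rightarrow> bool" where
  "lambda_less a b \<longleftrightarrow> fst a \<le> fst b \<and> snd b \<le> snd a \<and> a \<noteq> b"

text \<open>The point \<open>P\<^sub>\<tau>\<close> is \<open>P_tau k \<tau> x y\<close>, and its transpose is \<open>P_tau k \<tau> y x\<close>.\<close>

definition P_tau :: "nat \<Rightarrow> (nat \<Rightarrow> int) \<Rightarrow> real \<Rightarrow> real \<Rightarrow> nat \<Rightarrow> real" where
  "P_tau k \<tau> x y = (\<lambda>i\<in>{1..k}. if \<tau> i = 1 then x else y)"

definition has_period :: "nat \<Rightarrow> (nat \<Rightarrow> 'a) \<Rightarrow> bool" where
  "has_period q s \<longleftrightarrow> (\<forall>n. s (n + q) = s n)"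

definition minimal_period :: "nat \<Rightarrow> (nat \<Rightarrow> 'a) \<Rightarrow> bool" where
  "minimal_period q s \<longleftrightarrow>
     q > 0 \<and> has_period q s \<and> (\<forall>r. 0 < r \<and> r < q \<longrightarrow> \<not> has_period r s)"

text \<open>
  A sequence \<open>x\<^sub>1\<^sub>-\<^sub>k, \<dots>, x\<^sub>0, x\<^sub>1, \<dots>\<close> is stored with its index shifted: \<open>x m\<close> is the term of index
  \<open>m + 1 - k\<close>. Hence \<open>delay k x n\<close> is \<open>X\<^sub>n = (x\<^sub>n, \<dots>, x\<^bsub>n-k+1\<^esub>)\<close>, and \<open>x (n + k)\<close> is \<open>x\<^bsub>n+1\<^esub>\<close>.
\<close>

definition delay :: "nat \<Rightarrow> (nat \<Rightarrow> real) \<Rightarrow> nat \<Rightarrow> nat \<Rightarrow> real" where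
  "delay k x n = (\<lambda>i\<in>{1..k}. x (n + k - i))"

definition solution :: "nat \<Rightarrow> (nat \<Rightarrow> (nat \<Rightarrow> real) \<Rightarrow> real) \<Rightarrow> (nat \<Rightarrow> real) \<Rightarrow> bool" where
  "solution k F x \<longleftrightarrow> delay k x 0 \<in> orthant k \<and> (\<forall>n. x (n + k) = F n (delay k x n))"

text \<open>Periodicity covers the initial values too, so that \<open>X\<^sub>n\<close> is periodic from \<open>n = 0\<close> on.\<close>

definition is_cycle ::
  "nat \<Rightarrow> (nat \<Rightarrow> (nat \<Rightarrow> real) \<Rightarrow> real) \<Rightarrow> nat \<Rightarrow> (nat \<Rightarrow> real) \<Rightarrow> bool" where
  "is_cycle k F q x \<longleftrightarrow> solution k F x \<and> minimal_period q x"

definition Per :: "nat \<Rightarrow> (nat \<Rightarrow> (nat \<Rightarrow> real) \<Rightarrow> real) \<Rightarrow> real set" where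
  "Per k F = {x m | x m. solution k F x \<and> (\<exists>q>0. has_period q x)}"

text \<open>
  Limit points of an orbit are limits of subsequences of \<open>x\<^sub>n\<close> (not accumulation points of the
  set of values). Each initial condition determines exactly one solution.
\<close>

definition omega ::
  "nat \<Rightarrow> (nat \<Rightarrow> (nat \<Rightarrow> real) \<Rightarrow> real) \<Rightarrow> (nat \<Rightarrow> real) \<Rightarrow> real set" where
  "omega k F X0 = {l. \<exists>x r. solution k F x \<and> delay k x 0 = X0 \<and>
                        strict_mono (r :: nat \<Rightarrow> nat) \<and> (x \<circ> r) \<longlonglongrightarrow> l}"

text \<open>Convergence to a cycle is in phase: the cycle is itself a solution started at time 0.\<close>

definition globally_attracting ::
  "nat \<Rightarrow> (nat \<Rightarrow> (nat \<Rightarrow> real) \<Rightarrow> real) \<Rightarrow> (nat \<Rightarrow> real) \<Rightarrow> bool" where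
  "globally_attracting k F c \<longleftrightarrow> (\<forall>x. solution k F x \<longrightarrow> (\<lambda>n. x n - c n) \<longlonglongrightarrow> 0)"

definition G_map ::
  "nat \<Rightarrow> (nat \<Rightarrow> int) \<Rightarrow> ((nat \<Rightarrow> real) \<Rightarrow> real) \<Rightarrow>
   (nat \<Rightarrow> real) \<times> (nat \<Rightarrow> real) \<Rightarrow> (nat \<Rightarrow> real) \<times> (nat \<Rightarrow> real)" where
  "G_map k \<tau> f = (\<lambda>(X, U).
     (\<lambda>i\<in>{1..k}. if i = 1 then (if \<tau> 1 = 1 then f X else f U)
                 else if \<tau> (i - 1) * \<tau> i = 1 then X (i - 1) else U (i - 1),
      \<lambda>i\<in>{1..k}. if i = 1 then (if \<tau> 1 = 1 then f U else f X)
                 else if \<tau> (i - 1) * \<tau> i = 1 then U (i - 1) else X (i - 1)))"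

definition system_solution ::
  "nat \<Rightarrow> (nat \<Rightarrow> int) \<Rightarrow> (nat \<Rightarrow> (nat \<Rightarrow> real) \<Rightarrow> real) \<Rightarrow>
   (nat \<Rightarrow> (nat \<Rightarrow> real) \<times> (nat \<Rightarrow> real)) \<Rightarrow> bool" where
  "system_solution k \<tau> F \<xi> \<longleftrightarrow>
     \<xi> 0 \<in> orthant k \<times> orthant k \<and> (\<forall>n. \<xi> (Suc n) = G_map k \<tau> (F n) (\<xi> n))"

definition is_pseudo_cycle ::
  "nat \<Rightarrow> nat \<Rightarrow> (nat \<Rightarrow> int) \<Rightarrow> (nat \<Rightarrow> (nat \<Rightarrow> real) \<Rightarrow> real) \<Rightarrow>
   (nat \<Rightarrow> (nat \<Rightarrow> real) \<times> (nat \<Rightarrow> real)) \<Rightarrow> bool" where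
  "is_pseudo_cycle k p \<tau> F \<xi> \<longleftrightarrow>
     system_solution k \<tau> F \<xi> \<and>
     (\<exists>q. q dvd p \<and> minimal_period q \<xi> \<and>
          \<not> (\<exists>x. is_cycle k F q x \<and> (\<forall>n. \<xi> n = (delay k x n, delay k x n))))"

end

theory Submission imports Defs begin

text \<open>
  Untangling the components of \<open>G\<^sub>n\<close> according to the sign of \<open>\<tau>\<close> turns the system
  \<open>\<xi>\<^bsub>n+1\<^esub> = G\<^sub>n(\<xi>\<^sub>n)\<close> into a pair of scalar sequences \<open>a\<close>, \<open>b\<close>, where \<open>a\<close> is driven by \<open>F\<^sub>n\<close>
  evaluated at past values of \<open>a\<close> in the increasing and of \<open>b\<close> in the decreasing arguments, and
  conversely for \<open>b\<close>. Started from the corners \<open>x \<le> y\<close> of a box, the values of \<open>a\<close> increase and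
  those of \<open>b\<close> decrease along each residue class modulo \<open>p\<close>, and every solution of the scalar
  equation starting in the box stays between them. The limits form a \<open>p\<close>-periodic solution of the
  system; since it is not a pseudo-cycle, the two limits agree with a cycle of the scalar equation,
  which attracts the whole box. A single box contains the given cycle and any prescribed initial
  condition, so the attracting cycle is always the given one.
\<close>

section \<open>Periods of sequences\<close>

lemma has_period_mult:
  assumes "has_period q s"
  shows "s (n + j * q) = s n"
proof (induction j)
  case (Suc j)
  have "s (n + Suc j * q) = s ((n + j * q) + q)" by (simp add: algebra_simps)
  with assms Suc show ?case unfolding has_period_def by simp
qed simp

lemma minimal_period_dvd:
  assumes "minimal_period q s" and "has_period p s"
  shows "q dvd p"
proof (rule ccontr)
  assume "\<not> q dvd p"
  moreover have "q > 0" "has_period q s" using assms(1) unfolding minimal_period_def by auto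
  moreover have "has_period (p mod q) s"
    unfolding has_period_def
  proof
    fix n
    have "s (n + p mod q) = s (n + p mod q + (p div q) * q)"
      using has_period_mult[OF \<open>has_period q s\<close>] by metis
    also have "\<dots> = s (n + p)" by (simp add: algebra_simps)
    finally show "s (n + p mod q) = s n" using assms(2) unfolding has_period_def by simp
  qed
  ultimately show False
    using assms(1) unfolding minimal_period_def by (meson dvd_eq_mod_eq_0 mod_less_divisor neq0_conv)
qed

lemma exists_minimal_period:
  assumes "has_period p s" and "p > 0"
  obtains q where "minimal_period q s" "q dvd p"
proof -
  let ?q = "LEAST r. 0 < r \<and> has_period r s"
  have "0 < ?q \<and> has_period ?q s" by (rule LeastI[of _ p]) (use assms in simp)
  then have "minimal_period ?q s"
    unfolding minimal_period_def using not_less_Least by blast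
  then show thesis using that minimal_period_dvd assms(1) by blast
qed

lemma minimal_period_unique:
  assumes "minimal_period q s" and "minimal_period r s"
  shows "q = r"
  using assms minimal_period_dvd unfolding minimal_period_def by (metis dvd_antisym)

text \<open>Along \<open>n + j * (q * r)\<close> both sequences are constant in \<open>j\<close>, so
  their difference is a constant tending to 0. This turns attraction between cycles into
  equality.\<close>

lemma has_period_imp_eq:
  fixes s t :: "nat \<Rightarrow> real"
  assumes "has_period q s" "q > 0" and "has_period r t" "r > 0"
    and lim: "(\<lambda>n. s n - t n) \<longlonglongrightarrow> 0"
  shows "s = t"
proof
  fix n
  have "strict_mono (\<lambda>j. n + j * (q * r))" using assms by (simp add: strict_mono_def)
  from LIMSEQ_subseq_LIMSEQ[OF lim this]
  have "(\<lambda>j. s (n + j * (q * r)) - t (n + j * (q * r))) \<longlonglongrightarrow> 0" by (simp add: o_def)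
  moreover have "s (n + j * (q * r)) = s n" "t (n + j * (q * r)) = t n" for j
    using has_period_mult[OF assms(1), of n "j * r"] has_period_mult[OF assms(3), of n "j * q"]
    by (simp_all add: mult.assoc mult.commute mult.left_commute)
  ultimately show "s n = t n" by (simp add: LIMSEQ_const_iff)
qed

lemma has_period_finite_range:
  assumes "has_period q s" and "q > 0"
  shows "finite (range s)"
proof -
  have "s n = s (n mod q)" for n
    using has_period_mult[OF assms(1), of "n mod q" "n div q"] by simp
  then have "range s \<subseteq> s ` {..<q}"
    using assms(2) by (metis image_eqI image_subsetI lessThan_iff mod_less_divisor)
  then show ?thesis using finite_surj by blast
qed

section \<open>Limits along residue classes and delayed recurrences\<close>

text \<open>There are finitely many classes, so one threshold \<open>N\<close> serves them
  all.\<close>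

lemma tendsto_residue_classes:
  fixes f :: "nat \<Rightarrow> real"
  assumes "p > 0" and lim: "\<And>m. m < p \<Longrightarrow> (\<lambda>n. f (m + n * p)) \<longlonglongrightarrow> l"
  shows "f \<longlonglongrightarrow> l"
proof (rule LIMSEQ_I)
  fix e :: real
  assume "e > 0"
  then have "\<forall>m\<in>{..<p}. \<forall>\<^sub>F n in sequentially. norm (f (m + n * p) - l) < e"
    using LIMSEQ_D[OF lim] by (simp add: eventually_sequentially)
  then have "\<forall>\<^sub>F n in sequentially. \<forall>m\<in>{..<p}. norm (f (m + n * p) - l) < e"
    by (simp add: eventually_ball_finite)
  then obtain N where N: "norm (f (m + n * p) - l) < e" if "n \<ge> N" "m < p" for m n
    by (auto simp: eventually_sequentially)
  have "norm (f j - l) < e" if "j \<ge> N * p" for j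
    using N[of "j div p" "j mod p"] that assms(1) by (simp add: less_eq_div_iff_mult_less_eq)
  then show "\<exists>N. \<forall>j\<ge>N. norm (f j - l) < e" by blast
qed

lemma tendsto_coordinatewise:
  fixes g :: "nat \<Rightarrow> 'a \<Rightarrow> real"
  assumes "\<And>i. (\<lambda>j. g j i) \<longlonglongrightarrow> l i"
  shows "g \<longlonglongrightarrow> l"
  using assms limitin_componentwise[of "\<lambda>_. euclidean" UNIV g l sequentially]
  by (simp add: euclidean_product_topology)

text \<open>The term at \<open>n + k\<close> depends only on earlier ones because the delays
  \<open>i\<close> start at 1. The value type is arbitrary, so that both scalar solutions and
  coupled pairs of sequences are covered.\<close>

lemma exists_delay_recurrence:
  fixes \<Phi> :: "nat \<Rightarrow> (nat \<Rightarrow> 'a) \<Rightarrow> 'a"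
  obtains s where "\<And>m. m < k \<Longrightarrow> s m = init m"
    and "\<And>n. s (n + k) = \<Phi> n (\<lambda>i\<in>{1..k}. s (n + k - i))"
proof -
  let ?P = "\<lambda>f m r. r = (if m < k then init m else \<Phi> (m - k) (\<lambda>i\<in>{1..k}. f (m - i)))"
  have "\<exists>s. \<forall>m. ?P s m (s m)"
  proof (rule dependent_wellorder_choice)
    fix r m and f g :: "nat \<Rightarrow> 'a"
    assume "\<And>j. j < m \<Longrightarrow> f j = g j"
    then have "(\<lambda>i\<in>{1..k}. f (m - i)) = (\<lambda>i\<in>{1..k}. g (m - i))" if "\<not> m < k"
      using that by (intro restrict_ext) auto
    then show "?P f m r = ?P g m r" by auto
  qed blast
  then obtain s where s: "\<And>m. ?P s m (s m)" by blast
  show thesis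
  proof (rule that)
    show "s m = init m" if "m < k" for m using s[of m] that by simp
    show "s (n + k) = \<Phi> n (\<lambda>i\<in>{1..k}. s (n + k - i))" for n using s[of "n + k"] by simp
  qed
qed

section \<open>Untangling the doubled system\<close>

text \<open>The untangled form of \<open>\<xi>\<^sub>n = (X\<^sub>n, U\<^sub>n)\<close> is \<open>X\<^sub>n = interlace k \<tau> a b n\<close>,
  \<open>U\<^sub>n = interlace k \<tau> b a n\<close>; indices are shifted as in \<open>delay\<close>.\<close>

definition interlace ::
  "nat \<Rightarrow> (nat \<Rightarrow> int) \<Rightarrow> (nat \<Rightarrow> real) \<Rightarrow> (nat \<Rightarrow> real) \<Rightarrow> nat \<Rightarrow> nat \<Rightarrow> real" where
  "interlace k \<tau> a b n = (\<lambda>i\<in>{1..k}. if \<tau> i = 1 then a (n + k - i) else b (n + k - i))"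

lemma interlace_same: "interlace k \<tau> u u = delay k u"
  unfolding interlace_def delay_def by (intro ext) simp

lemma interlace_const: "interlace k \<tau> (\<lambda>_. x) (\<lambda>_. y) n = P_tau k \<tau> x y"
  unfolding interlace_def P_tau_def by simp

lemma interlace_in_orthant:
  assumes "\<And>m. m < n + k \<Longrightarrow> 0 \<le> a m" and "\<And>m. m < n + k \<Longrightarrow> 0 \<le> b m"
  shows "interlace k \<tau> a b n \<in> orthant k"
  using assms unfolding interlace_def orthant_def by auto

lemma interlace_shift:
  "interlace k \<tau> a b (n + d) = interlace k \<tau> (\<lambda>m. a (m + d)) (\<lambda>m. b (m + d)) n"
  unfolding interlace_def by (rule restrict_ext) (simp add: add.commute add.left_commute)

lemma tau_le_interlace:
  assumes "\<And>m. m < n + k \<Longrightarrow> a m \<le> a' m" and "\<And>m. m < n + k \<Longrightarrow> b' m \<le> b m"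
  shows "tau_le k \<tau> (interlace k \<tau> a b n) (interlace k \<tau> a' b' n)"
  using assms unfolding interlace_def tau_le_def by simp

text \<open>Entry \<open>i - 1\<close> of a vector comes from \<open>a\<close> or \<open>b\<close>
  according to the sign of \<open>\<tau> (i - 1)\<close>. Moved to position \<open>i\<close> it must
  follow the sign of \<open>\<tau> i\<close>; hence \<open>G_map\<close> swaps the two vectors'
  entries exactly when the signs differ.\<close>

lemma G_map_interlace:
  assumes "k \<ge> 1" and \<tau>: "\<tau> \<in> {1..k} \<rightarrow> {-1, 1}"
    and "a (n + k) = f (interlace k \<tau> a b n)" and "b (n + k) = f (interlace k \<tau> b a n)"
  shows "G_map k \<tau> f (interlace k \<tau> a b n, interlace k \<tau> b a n) =
    (interlace k \<tau> a b (Suc n), interlace k \<tau> b a (Suc n))"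
proof -
  have "(\<lambda>i\<in>{1..k}. if i = 1 then (if \<tau> 1 = 1 then f (interlace k \<tau> a b n) else f (interlace k \<tau> b a n))
           else if \<tau> (i - 1) * \<tau> i = 1 then interlace k \<tau> a b n (i - 1)
           else interlace k \<tau> b a n (i - 1)) = interlace k \<tau> a b (Suc n)"
    if rec: "a (n + k) = f (interlace k \<tau> a b n)" "b (n + k) = f (interlace k \<tau> b a n)" for a b
  proof -
    have "(if i = 1 then (if \<tau> 1 = 1 then f (interlace k \<tau> a b n) else f (interlace k \<tau> b a n))
           else if \<tau> (i - 1) * \<tau> i = 1 then interlace k \<tau> a b n (i - 1)
           else interlace k \<tau> b a n (i - 1)) =
        (if \<tau> i = 1 then a (Suc n + k - i) else b (Suc n + k - i))" if i: "i \<in> {1..k}" for i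
    proof (cases "i = 1")
      case True
      then show ?thesis by (simp add: rec)
    next
      case False
      then have "i - 1 \<in> {1..k}" "n + k - (i - 1) = Suc n + k - i" using i by auto
      moreover have "\<tau> i \<in> {-1, 1}" "\<tau> (i - 1) \<in> {-1, 1}" using \<tau> i calculation(1) by blast+
      ultimately show ?thesis using False unfolding interlace_def by auto
    qed
    then show ?thesis unfolding interlace_def[of k \<tau> a b "Suc n"] by (rule restrict_ext)
  qed
  from this[OF assms(3,4)] this[OF assms(4,3)] show ?thesis unfolding G_map_def by simp
qed

section \<open>Attraction inside a box\<close>

locale tau_monotone_equation =
  fixes k p :: nat
    and F :: "nat \<Rightarrow> (nat \<Rightarrow> real) \<Rightarrow> real"
    and \<tau> :: "nat \<Rightarrow> int"
  assumes k: "k \<ge> 1" and p: "p \<ge> 1"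
    and nonneg: "\<And>n. F n \<in> orthant k \<rightarrow> {0..}"
    and cont: "\<And>n. continuous_on (orthant k) (F n)"
    and period: "has_period p (\<lambda>n. restrict (F n) (orthant k))"
    and \<tau>: "\<tau> \<in> {1..k} \<rightarrow> {-1, 1}"
    and mono: "\<And>n. monotone_on (orthant k) (tau_le k \<tau>) (\<le>) (F n)"
begin

lemma F_le:
  assumes "X \<in> orthant k" "Y \<in> orthant k" "tau_le k \<tau> X Y"
  shows "F n X \<le> F n Y"
  using monotone_onD[OF mono] assms by blast

lemma F_mod:
  assumes "X \<in> orthant k"
  shows "F (n + j * p) X = F n X"
  using fun_cong[OF has_period_mult[OF period, of n j], of X] assms by simp

lemma solution_nonneg:
  assumes "solution k F u"
  shows "0 \<le> u m"
proof (induction m rule: less_induct)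
  case (less m)
  show ?case
  proof (cases "m < k")
    case True
    \<comment> \<open>In the shifted indexing, the initial value \<open>u m\<close> is entry
      \<open>k - m\<close> of the initial vector.\<close>
    then have km: "k - m \<in> {1..k}" by simp
    with assms have "delay k u 0 (k - m) \<in> {0..}"
      unfolding solution_def orthant_def by (blast dest: PiE_mem)
    then show ?thesis using True km unfolding delay_def by (simp split: if_splits)
  next
    case False
    then obtain n where m: "m = n + k" by (metis le_add_diff_inverse2 not_le)
    have "delay k u n \<in> orthant k"
      unfolding interlace_same[of k \<tau>, symmetric] using less m by (intro interlace_in_orthant) auto
    then show ?thesis using assms nonneg[of n] m unfolding solution_def by (metis PiE atLeast_iff funcset_mem)
  qed
qed

lemma exists_solution:
  assumes "X0 \<in> orthant k"
  obtains u where "solution k F u" "delay k u 0 = X0"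
proof -
  obtain u where u: "\<And>m. m < k \<Longrightarrow> u m = X0 (k - m)"
    and rec: "\<And>n. u (n + k) = F n (\<lambda>i\<in>{1..k}. u (n + k - i))"
    using exists_delay_recurrence[of k "\<lambda>m. X0 (k - m)" F] by blast
  have "delay k u 0 = X0"
    unfolding delay_def
  proof
    fix i
    show "(\<lambda>i\<in>{1..k}. u (0 + k - i)) i = X0 i"
      using u[of "k - i"] assms unfolding orthant_def by (cases "i \<in> {1..k}") (auto simp: PiE_def extensional_def)
  qed
  moreover have "solution k F u"
    unfolding solution_def using calculation rec assms unfolding delay_def by simp
  ultimately show thesis using that by blast
qed

text \<open>Attraction is claimed for every solution starting in the box, so it can be applied to an
  arbitrary solution and to the given cycle alike.\<close>

lemma box_attracting_cycle:
  assumes no_pseudo: "\<not> (\<exists>\<xi>. is_pseudo_cycle k p \<tau> F \<xi>)"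
    and x: "0 \<le> x" and xy: "x \<le> y"
    and lower: "\<And>j. j < p \<Longrightarrow> x \<le> F j (P_tau k \<tau> x y)"
    and upper: "\<And>j. j < p \<Longrightarrow> F j (P_tau k \<tau> y x) \<le> y"
  obtains r c where "is_cycle k F r c" "r dvd p"
    and "\<forall>u. solution k F u \<longrightarrow> (\<forall>m<k. u m \<in> {x..y}) \<longrightarrow> (\<lambda>n. u n - c n) \<longlonglongrightarrow> 0"
proof -
  \<comment> \<open>The sequences \<open>a\<close> and \<open>b\<close> drive each other, so they
    are built together as one recurrence on pairs.\<close>
  define \<Phi> where "\<Phi> n S =
      (F n (\<lambda>i\<in>{1..k}. if \<tau> i = 1 then fst (S i) else snd (S i)),
       F n (\<lambda>i\<in>{1..k}. if \<tau> i = 1 then snd (S i) else fst (S i)))" for n and S :: "nat \<Rightarrow> real \<times> real"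
  obtain s where s0: "\<And>m. m < k \<Longrightarrow> s m = (x, y)"
    and s_rec: "\<And>n. s (n + k) = \<Phi> n (\<lambda>i\<in>{1..k}. s (n + k - i))"
    using exists_delay_recurrence[of k "\<lambda>_. (x, y)" \<Phi>] by blast
  define a where "a m = fst (s m)" for m
  define b where "b m = snd (s m)" for m
  have a0: "a m = x" and b0: "b m = y" if "m < k" for m using that s0 by (simp_all add: a_def b_def)
  have a_rec: "a (n + k) = F n (interlace k \<tau> a b n)"
    and b_rec: "b (n + k) = F n (interlace k \<tau> b a n)" for n
    unfolding a_def b_def s_rec \<Phi>_def interlace_def fst_conv snd_conv
    by (rule arg_cong[where f = "F n"], rule restrict_ext, simp)+
  have le_induct: "Q m"
    if init: "\<And>m. m < k \<Longrightarrow> Q m" and step: "\<And>n. (\<And>m. m < n + k \<Longrightarrow> Q m) \<Longrightarrow> Q (n + k)"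
    for Q and m :: nat
  proof (induction m rule: less_induct)
    case (less m)
    then show ?case using init step[of "m - k"] by (cases "m < k") auto
  qed
  have P: "P_tau k \<tau> x y \<in> orthant k" "P_tau k \<tau> y x \<in> orthant k"
    using x xy unfolding P_tau_def orthant_def by auto
  have lower': "x \<le> F n (P_tau k \<tau> x y)" and upper': "F n (P_tau k \<tau> y x) \<le> y" for n
    using F_mod[OF P(1), of "n mod p" "n div p"] F_mod[OF P(2), of "n mod p" "n div p"]
      lower[of "n mod p"] upper[of "n mod p"] p by simp_all
  have squeeze: "x \<le> a m \<and> a m \<le> u m \<and> u m \<le> b m \<and> b m \<le> y"
    if u: "solution k F u" and u0: "\<And>m. m < k \<Longrightarrow> u m \<in> {x..y}" for u m
  proof (induction m rule: le_induct)
    case (1 m)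
    then show ?case using a0 b0 u0 by simp
  next
    case (2 n)
    have nn: "0 \<le> a m" "0 \<le> b m" "0 \<le> u m" if "m < n + k" for m using 2[OF that] x by linarith+
    note orth = interlace_in_orthant[where k = k and n = n and \<tau> = \<tau>]
    \<comment> \<open>These comparisons form a chain from corner to corner. Applying
      \<open>F n\<close> gives the claim at \<open>n + k\<close>, with \<open>lower'\<close> and
      \<open>upper'\<close> closing the two ends.\<close>
    have "tau_le k \<tau> (P_tau k \<tau> x y) (interlace k \<tau> a b n)"
      "tau_le k \<tau> (interlace k \<tau> a b n) (delay k u n)"
      "tau_le k \<tau> (delay k u n) (interlace k \<tau> b a n)"
      "tau_le k \<tau> (interlace k \<tau> b a n) (P_tau k \<tau> y x)"
      using 2 tau_le_interlace[where k = k and n = n and \<tau> = \<tau>]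
      unfolding interlace_same[of k \<tau>, symmetric] interlace_const[of k \<tau> _ _ n, symmetric] by simp_all
    moreover have "interlace k \<tau> a b n \<in> orthant k" "interlace k \<tau> b a n \<in> orthant k"
      "delay k u n \<in> orthant k"
      unfolding interlace_same[of k \<tau>, symmetric] by (intro orth nn; assumption)+
    moreover have "u (n + k) = F n (delay k u n)" using u unfolding solution_def by blast
    ultimately show ?case
      unfolding a_rec b_rec using F_le P lower'[of n] upper'[of n] order_trans by metis
  qed
  \<comment> \<open>\<open>squeeze\<close> bounds \<open>a\<close> and \<open>b\<close> only in the
    presence of a solution in the box; the one started at a corner is such a witness.\<close>
  obtain v where v: "solution k F v" "delay k v 0 = P_tau k \<tau> x y"
    using exists_solution P by blast
  have "v m \<in> {x..y}" if "m < k" for m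
    using fun_cong[OF v(2), of "k - m"] that xy unfolding delay_def P_tau_def
    by (auto split: if_splits)
  then have bounds: "x \<le> a m" "a m \<le> b m" "b m \<le> y" for m
    using squeeze[OF v(1)] by (blast intro: order_trans)+
  have "0 \<le> a m" "0 \<le> b m" for m using bounds(1,2)[of m] x by linarith+
  then have orth: "interlace k \<tau> a b n \<in> orthant k" "interlace k \<tau> b a n \<in> orthant k" for n
    by (simp_all add: interlace_in_orthant)
  \<comment> \<open>At the initial indices \<open>a\<close> and \<open>b\<close> sit at the ends of
    the box, so \<open>bounds\<close> gives the base case; the step combines monotonicity with the
    \<open>p\<close>-periodicity of \<open>F\<close>.\<close>
  have mono_p: "a m \<le> a (m + p) \<and> b (m + p) \<le> b m" for m
  proof (induction m rule: le_induct)
    case (1 m)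
    then show ?case using a0 b0 bounds by simp
  next
    case (2 n)
    have "tau_le k \<tau> (interlace k \<tau> a b n) (interlace k \<tau> a b (n + p))"
      "tau_le k \<tau> (interlace k \<tau> b a (n + p)) (interlace k \<tau> b a n)"
      unfolding interlace_shift[where d = p] by (rule tau_le_interlace; use 2 in simp)+
    then have "F n (interlace k \<tau> a b n) \<le> F n (interlace k \<tau> a b (n + p))"
      "F n (interlace k \<tau> b a (n + p)) \<le> F n (interlace k \<tau> b a n)"
      using F_le orth by blast+
    moreover have "F (n + p) X = F n X" if "X \<in> orthant k" for X using F_mod[OF that, of n 1] by simp
    ultimately show ?case
      using a_rec b_rec orth by (metis add.assoc add.commute)
  qed
  have "\<exists>l. (\<lambda>n. a (m + n * p)) \<longlonglongrightarrow> l" for m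
  proof -
    have "incseq (\<lambda>n. a (m + n * p))"
      using mono_p by (intro incseq_SucI) (metis add.assoc add.commute mult_Suc)
    then show ?thesis using incseq_convergent bounds by (metis order_trans)
  qed
  then obtain A where A: "\<And>m. (\<lambda>n. a (m + n * p)) \<longlonglongrightarrow> A m" by metis
  have "\<exists>l. (\<lambda>n. b (m + n * p)) \<longlonglongrightarrow> l" for m
  proof -
    have "decseq (\<lambda>n. b (m + n * p))"
      using mono_p by (intro decseq_SucI) (metis add.assoc add.commute mult_Suc)
    then show ?thesis using decseq_convergent bounds by (metis order_trans)
  qed
  then obtain B where B: "\<And>m. (\<lambda>n. b (m + n * p)) \<longlonglongrightarrow> B m" by metis
  have shift: "L (m + p) = L m"
    if "\<And>m. (\<lambda>n. g (m + n * p)) \<longlonglongrightarrow> L m" for g L :: "nat \<Rightarrow> real" and m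
  proof -
    have "(\<lambda>n. g ((m + p) + n * p)) \<longlonglongrightarrow> L m"
      using LIMSEQ_Suc[OF that[of m]] by (simp add: algebra_simps)
    then show ?thesis using that LIMSEQ_unique by blast
  qed
  have nn: "0 \<le> A m" "0 \<le> B m" for m
    by (rule LIMSEQ_le_const[OF A] LIMSEQ_le_const[OF B],
        use bounds x in \<open>blast intro: order_trans\<close>)+
  \<comment> \<open>Along \<open>n + j * p\<close> the map stays \<open>F n\<close> and each entry
    runs through one residue class, so continuity passes the recurrence to the limit. It is used
    twice, with the roles of the sequences exchanged.\<close>
  have lim_rec: "L (n + k) = F n (interlace k \<tau> L M n)"
    if g: "\<And>m. (\<lambda>n. g (m + n * p)) \<longlonglongrightarrow> L m" and h: "\<And>m. (\<lambda>n. h (m + n * p)) \<longlonglongrightarrow> M m"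
      and orth: "\<And>n. interlace k \<tau> g h n \<in> orthant k" "interlace k \<tau> L M n \<in> orthant k"
      and rec: "\<And>n. g (n + k) = F n (interlace k \<tau> g h n)"
    for g h L M :: "nat \<Rightarrow> real" and n
  proof -
    have "(\<lambda>j. interlace k \<tau> g h (n + j * p)) \<longlonglongrightarrow> interlace k \<tau> L M n"
      unfolding interlace_shift
    proof (rule tendsto_coordinatewise)
      fix i
      show "(\<lambda>j. interlace k \<tau> (\<lambda>m. g (m + j * p)) (\<lambda>m. h (m + j * p)) n i)
          \<longlonglongrightarrow> interlace k \<tau> L M n i"
        using g[of "n + k - i"] h[of "n + k - i"] unfolding interlace_def restrict_def
        by (cases "i \<in> {1..k}"; cases "\<tau> i = 1") (simp_all only: refl if_True if_False tendsto_const)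
    qed
    then have "(\<lambda>j. F n (interlace k \<tau> g h (n + j * p))) \<longlonglongrightarrow> F n (interlace k \<tau> L M n)"
      by (rule continuous_on_tendsto_compose[OF cont]) (use orth in auto)
    moreover have "F n (interlace k \<tau> g h (n + j * p)) = g ((n + k) + j * p)" for j
      using rec[of "n + j * p"] F_mod[OF orth(1)] by (simp add: algebra_simps)
    ultimately show ?thesis using g[of "n + k"] LIMSEQ_unique by simp
  qed
  have orth_lim: "interlace k \<tau> A B n \<in> orthant k" "interlace k \<tau> B A n \<in> orthant k" for n
    using nn by (simp_all add: interlace_in_orthant)
  have A_rec: "A (n + k) = F n (interlace k \<tau> A B n)"
    and B_rec: "B (n + k) = F n (interlace k \<tau> B A n)" for n
    using lim_rec[OF A B orth(1) orth_lim(1) a_rec] lim_rec[OF B A orth(2) orth_lim(2) b_rec] by blast+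
  define \<xi> where "\<xi> n = (interlace k \<tau> A B n, interlace k \<tau> B A n)" for n
  have "system_solution k \<tau> F \<xi>"
    unfolding system_solution_def \<xi>_def
    using orth_lim G_map_interlace[where f = "F n" for n, OF k \<tau> A_rec B_rec] by simp
  moreover have "has_period p \<xi>"
    unfolding has_period_def \<xi>_def interlace_shift using shift[OF A] shift[OF B] by simp
  then obtain r where "minimal_period r \<xi>" "r dvd p" using exists_minimal_period p by auto
  \<comment> \<open>The minimal period of \<open>\<xi>\<close> divides \<open>p\<close>, so if
    \<open>\<xi>\<close> did not arise from a cycle it would be a pseudo-cycle.\<close>
  ultimately obtain c where c: "is_cycle k F r c" and "\<And>n. \<xi> n = (delay k c n, delay k c n)"
    using no_pseudo unfolding is_pseudo_cycle_def by blast
  then have eq: "interlace k \<tau> A B n i = delay k c n i" "interlace k \<tau> B A n i = delay k c n i" for n i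
    unfolding \<xi>_def by simp_all
  have limits: "A m = c m" "B m = c m" for m
  proof -
    \<comment> \<open>A window \<open>n\<close> and a position \<open>i\<close> showing index
      \<open>m\<close>: position 1 if \<open>m \<ge> k - 1\<close>; otherwise the truncated
      subtraction gives window 0. Whichever of \<open>A\<close>, \<open>B\<close> stands there in
      one vector, the other stands there in the second.\<close>
    define n where "n = m - (k - 1)"
    define i where "i = n + k - m"
    have "i \<in> {1..k}" "n + k - i = m" using k unfolding n_def i_def by auto
    then show "A m = c m" "B m = c m"
      using eq[of n i] unfolding interlace_def delay_def by (auto split: if_splits)
  qed
  have c_period: "has_period p c"
    unfolding has_period_def limits(1)[symmetric] using shift[OF A] by simp
  have attracting: "(\<lambda>n. u n - c n) \<longlonglongrightarrow> 0"
    if u: "solution k F u" "\<And>m. m < k \<Longrightarrow> u m \<in> {x..y}" for u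
  proof (rule tendsto_residue_classes)
    show "p > 0" using p by simp
    fix m
    have "a m \<le> u m" "u m \<le> b m" for m using squeeze[OF u] by blast+
    then have "(\<lambda>n. u (m + n * p)) \<longlonglongrightarrow> c m"
      by (intro tendsto_sandwich[OF _ _ A[of m, unfolded limits] B[of m, unfolded limits]]) simp_all
    then show "(\<lambda>n. u (m + n * p) - c (m + n * p)) \<longlonglongrightarrow> 0"
      unfolding has_period_mult[OF c_period] by (rule LIM_zero)
  qed
  show thesis using that[OF c \<open>r dvd p\<close>] attracting by blast
qed

end

section \<open>From boxes to global attraction\<close>

theorem theorem3p3:
  fixes k p q :: nat
    and F :: "nat \<Rightarrow> (nat \<Rightarrow> real) \<Rightarrow> real"
    and \<tau> :: "nat \<Rightarrow> int"
  assumes "k \<ge> 1" and "p \<ge> 1"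
    and "\<And>n. F n \<in> orthant k \<rightarrow> {0..}"
    and "\<And>n. continuous_on (orthant k) (F n)"
    and "minimal_period p (\<lambda>n. restrict (F n) (orthant k))"
    and "\<tau> \<in> {1..k} \<rightarrow> {-1, 1}"
    and "\<And>n. monotone_on (orthant k) (tau_le k \<tau>) (\<le>) (F n)"
    and "\<exists>!c. is_cycle k F q c"
    and "\<not> (\<exists>\<xi>. is_pseudo_cycle k p \<tau> F \<xi>)"
    and "\<And>X0. X0 \<in> orthant k \<Longrightarrow>
           \<exists>x y. 0 \<le> x \<and> x < y \<and>
             tau_less k \<tau> (P_tau k \<tau> x y) X0 \<and> tau_less k \<tau> X0 (P_tau k \<tau> y x) \<and>
             (\<forall>j<p. lambda_less (x, y) (F j (P_tau k \<tau> x y), F j (P_tau k \<tau> y x)))"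
  shows "(\<forall>X0\<in>orthant k. omega k F X0 = Per k F) \<and>
         q dvd p \<and> (\<exists>c. is_cycle k F q c \<and> globally_attracting k F c)"
proof -
  interpret tau_monotone_equation k p F \<tau>
    using assms(1-4,6,7) assms(5)[unfolded minimal_period_def] by unfold_locales auto
  \<comment> \<open>With one coordinate, a box around the zero vector has \<open>x = 0\<close>, so
    one of its corners equals that vector, against the strict ordering.\<close>
  have "k \<noteq> 1"
  proof
    assume k: "k = 1"
    let ?X0 = "\<lambda>i\<in>{1..k}. 0 :: real"
    have "?X0 \<in> orthant k" unfolding orthant_def by simp
    from assms(10)[OF this] obtain x y where xy: "0 \<le> x" "x < y"
      "tau_less k \<tau> (P_tau k \<tau> x y) ?X0" "tau_less k \<tau> ?X0 (P_tau k \<tau> y x)" by blast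
    have "\<tau> 1 = 1 \<or> \<tau> 1 = -1" using assms(6) k by auto
    moreover have "P_tau k \<tau> x y = ?X0" if "x = 0" "\<tau> 1 = 1"
      unfolding P_tau_def using that k by (intro restrict_ext) auto
    moreover have "P_tau k \<tau> y x = ?X0" if "x = 0" "\<tau> 1 = -1"
      unfolding P_tau_def using that k by (intro restrict_ext) auto
    moreover have "x = 0"
      using xy k calculation(1) unfolding tau_less_def tau_le_def P_tau_def by auto
    ultimately show False using xy(3,4) unfolding tau_less_def by argo
  qed
  then have k2: "k \<ge> 2" using assms(1) by simp
  have large_box: "\<exists>y\<ge>M. 0 \<le> y \<and> (\<forall>j<p. 0 \<le> F j (P_tau k \<tau> 0 y) \<and> F j (P_tau k \<tau> y 0) \<le> y)"
    if "M \<ge> 0" for M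
  proof -
    \<comment> \<open>The zero entry forces \<open>x = 0\<close>; the entry \<open>M\<close> needs a second coordinate.\<close>
    define X0 where "X0 = (\<lambda>i\<in>{1..k}. if i = 1 then 0 else M)"
    have "X0 \<in> orthant k" unfolding X0_def orthant_def using that by auto
    from assms(10)[OF this] obtain x y where xy: "0 \<le> x" "x < y"
      "tau_less k \<tau> (P_tau k \<tau> x y) X0" "tau_less k \<tau> X0 (P_tau k \<tau> y x)"
      "\<forall>j<p. lambda_less (x, y) (F j (P_tau k \<tau> x y), F j (P_tau k \<tau> y x))" by blast
    \<comment> \<open>For either sign of \<open>\<tau> i\<close>, one corner bounds the entry below
      and the other above.\<close>
    have "x \<le> X0 i \<and> X0 i \<le> y" if "i \<in> {1..k}" for i
    proof -
      have "\<tau> i = 1 \<or> \<tau> i = -1" using assms(6) that by auto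
      then show ?thesis using xy(3,4) that unfolding tau_less_def tau_le_def P_tau_def
        by (elim disjE) fastforce+
    qed
    from this[of 1] this[of 2] have "x = 0" "M \<le> y" using xy(1) k2 unfolding X0_def by auto
    then show ?thesis using xy unfolding lambda_less_def by auto
  qed
  obtain c where c: "is_cycle k F q c" using assms(8) by blast
  then have c_sol: "solution k F c" and "minimal_period q c" unfolding is_cycle_def by auto
  then have c_per: "has_period q c" "q > 0" unfolding minimal_period_def by auto
  have main: "(\<lambda>n. u n - c n) \<longlonglongrightarrow> 0 \<and> q dvd p" if u: "solution k F u" for u
  proof -
    \<comment> \<open>All terms are nonnegative, so this sum dominates every initial value of both
      \<open>u\<close> and \<open>c\<close>, and one box contains both.\<close>
    define M where "M = (\<Sum>m<k. u m + c m)"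
    have M: "u m \<le> M" "c m \<le> M" if "m < k" for m
    proof -
      have "u m + c m \<le> M"
        unfolding M_def using that u c_sol solution_nonneg
        by (intro member_le_sum[of _ _ "\<lambda>m. u m + c m"]) auto
      then show "u m \<le> M" "c m \<le> M"
        using solution_nonneg[OF u, of m] solution_nonneg[OF c_sol, of m] by linarith+
    qed
    then have "M \<ge> 0" unfolding M_def using solution_nonneg u c_sol by (intro sum_nonneg) simp
    from large_box[OF this] obtain y where y: "M \<le> y" "0 \<le> y"
      "\<And>j. j < p \<Longrightarrow> 0 \<le> F j (P_tau k \<tau> 0 y)" "\<And>j. j < p \<Longrightarrow> F j (P_tau k \<tau> y 0) \<le> y"
      by blast
    obtain r d where d: "is_cycle k F r d" "r dvd p"
      and attr: "\<forall>u. solution k F u \<longrightarrow> (\<forall>m<k. u m \<in> {0..y}) \<longrightarrow> (\<lambda>n. u n - d n) \<longlonglongrightarrow> 0"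
      by (rule box_attracting_cycle[OF assms(9) order_refl y(2-4)])
    have box: "u m \<in> {0..y}" "c m \<in> {0..y}" if "m < k" for m
      using M[OF that] y(1) solution_nonneg[OF u] solution_nonneg[OF c_sol] by auto
    have "minimal_period r d" using d(1) unfolding is_cycle_def by blast
    then have "has_period r d" "r > 0" unfolding minimal_period_def by auto
    \<comment> \<open>The given cycle also starts in the box, hence is attracted to
      \<open>d\<close>; two asymptotic periodic sequences coincide.\<close>
    then have "c = d" using has_period_imp_eq[OF c_per] attr c_sol box(2) by blast
    moreover have "q = r"
      using minimal_period_unique \<open>minimal_period q c\<close> \<open>minimal_period r d\<close> calculation by blast
    ultimately show ?thesis using attr u box(1) d(2) by blast
  qed
  have Per: "Per k F = range c"
  proof
    show "Per k F \<subseteq> range c"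
      \<comment> \<open>A periodic solution is asymptotic to \<open>c\<close> by
        \<open>main\<close>, hence equal to it.\<close>
      unfolding Per_def using main has_period_imp_eq c_per by blast
    show "range c \<subseteq> Per k F" unfolding Per_def using c_sol c_per by blast
  qed
  have "omega k F X0 = Per k F" if X0: "X0 \<in> orthant k" for X0
  proof
    show "omega k F X0 \<subseteq> Per k F"
    proof
      fix l
      assume "l \<in> omega k F X0"
      then obtain u r where u: "solution k F u" and r: "strict_mono (r :: nat \<Rightarrow> nat)"
        and l: "(u \<circ> r) \<longlonglongrightarrow> l" unfolding omega_def by blast
      have "(\<lambda>n. u (r n) - c (r n)) \<longlonglongrightarrow> 0"
        using LIMSEQ_subseq_LIMSEQ[OF conjunct1[OF main[OF u]] r] by (simp add: o_def)
      from tendsto_diff[OF l this] have "(\<lambda>n. c (r n)) \<longlonglongrightarrow> l" by simp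
      \<comment> \<open>A cycle has finitely many values, so a limit of its values is again one of
        them.\<close>
      moreover have "closed (range c)"
        using has_period_finite_range[OF c_per] by (rule finite_imp_closed)
      ultimately show "l \<in> Per k F"
        unfolding Per using closed_sequentially[of "range c" "\<lambda>n. c (r n)" l] by blast
    qed
    show "Per k F \<subseteq> omega k F X0"
      unfolding Per
    proof clarify
      fix m
      obtain u where u: "solution k F u" "delay k u 0 = X0"
        using exists_solution X0 by blast
      \<comment> \<open>Along these indices \<open>c\<close> is constantly \<open>c m\<close>, so
        \<open>u\<close> converges to that value.\<close>
      have r: "strict_mono (\<lambda>j. m + j * q)" using c_per(2) by (simp add: strict_mono_def)
      have "(\<lambda>j. u (m + j * q) - c m) \<longlonglongrightarrow> 0"
        using LIMSEQ_subseq_LIMSEQ[OF conjunct1[OF main[OF u(1)]] r] has_period_mult[OF c_per(1)]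
        by (simp add: o_def)
      then have "(u \<circ> (\<lambda>j. m + j * q)) \<longlonglongrightarrow> c m" by (simp add: o_def LIM_zero_cancel)
      with u r show "c m \<in> omega k F X0" unfolding omega_def by blast
    qed
  qed
  then show ?thesis using c main c_sol unfolding globally_attracting_def by blast
qed

end
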